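(* Let $p$ be a nonzero trim self-inversive polynomial of darga $n$. Then $\mathrm{cn}(p)$ is the largest real value of $\alpha$ for which the polynomial $\dfrac{p_\alpha(x)}{\gcd(p(x),x^n+1)}$ (in the variable $x$) has a double root.
   Context: For a nonzero polynomial $p(x)=\sum_{j=r}^{s}p_jx^j$ with $p_r,p_s\neq 0$, its darga is $r+s$. A complex polynomial of darga $n$ is self-inversive if $p_j=\overline{p_{n-j}}$ for all $j$; it is trim if $p(0)=0$. For real $\alpha$ put $p_\alpha(x)=\alpha(x^n+1)+p(x)$. A polynomial is circle rooted if all its roots lie on the unit circle. The circle number is $\mathrm{cn}(p)=\inf\{\alpha>0:p_\beta\text{ is circle rooted for all }\beta>\alpha\}$. *)

theory Defs
  imports Complex_Main "HOL-Computational_Algebra.Computational_Algebra"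
    "HOL-Computational_Algebra.Field_as_Ring"
begin

text \<open>
  \<open>darga\<close>, and hence everything built on it, is meaningful only for nonzero polynomials.
\<close>

definition darga :: "'a::zero poly \<Rightarrow> nat" where
  "darga p = (LEAST j. coeff p j \<noteq> 0) + degree p"

definition self_inversive :: "complex poly \<Rightarrow> bool" where
  "self_inversive p \<longleftrightarrow> (\<forall>j\<le>darga p. coeff p j = cnj (coeff p (darga p - j)))"

definition trim :: "complex poly \<Rightarrow> bool" where
  "trim p \<longleftrightarrow> poly p 0 = 0"

text \<open>The polynomial \<open>p\<^sub>\<alpha>(x) = \<alpha>(x\<^sup>n + 1) + p(x)\<close> with \<open>n\<close> the darga of \<open>p\<close>.\<close>

definition shifted_poly :: "complex poly \<Rightarrow> real \<Rightarrow> complex poly" where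
  "shifted_poly p \<alpha> = smult (of_real \<alpha>) (monom 1 (darga p) + 1) + p"

definition circle_rooted :: "complex poly \<Rightarrow> bool" where
  "circle_rooted p \<longleftrightarrow> (\<forall>z. poly p z = 0 \<longrightarrow> cmod z = 1)"

text \<open>
  The set below is bounded below by 0, and for nonzero trim self-inversive \<open>p\<close> it is
  nonempty (the roots of \<open>p\<^sub>\<alpha>\<close> lie on the circle for large \<open>\<alpha>\<close>), so the infimum over
  the reals is the usual one.
\<close>

definition circle_number :: "complex poly \<Rightarrow> real" where
  "circle_number p = Inf {\<alpha>. \<alpha> > 0 \<and> (\<forall>\<beta>>\<alpha>. circle_rooted (shifted_poly p \<beta>))}"

text \<open>
  A double root is a root of multiplicity at least two. The value of \<open>order\<close> at
  the zero polynomial is arbitrary, hence the first conjunct.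
\<close>

definition has_double_root :: "complex poly \<Rightarrow> bool" where
  "has_double_root q \<longleftrightarrow> q \<noteq> 0 \<and> (\<exists>z. order z q \<ge> 2)"

end

theory Submission
  imports Defs "HOL-Complex_Analysis.Conformal_Mappings"
begin

text \<open>
  With \<open>g = gcd p (x\<^sup>n + 1)\<close>, \<open>p = g u\<close> and \<open>x\<^sup>n + 1 = g v\<close>, the roots of \<open>p\<^sub>\<alpha> / g = \<alpha> v + u\<close>
  are the preimages of \<open>\<alpha>\<close> under the rational function \<open>f = - u / v\<close>, and its double roots are the
  critical points of \<open>f\<close> with value \<open>\<alpha>\<close>. Self-inversiveness makes \<open>f\<close> commute with reflection:
  \<open>f (1 / cnj w) = cnj (f w)\<close>. Near a simple root on the circle \<open>f\<close> is injective, so a nearby preimage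
  of a real number equals its own reflection and stays on the circle; by a degree count circle
  rootedness therefore persists under small changes of \<open>\<alpha>\<close> as long as all roots are simple. Applied at
  \<open>\<alpha> = \<infinity>\<close> this shows that \<open>cn p\<close> is finite, and applied at \<open>\<alpha> = cn p\<close> it forces a double root there.
  Conversely, at a critical point of order \<open>k \<ge> 2\<close> the preimages of the real line form \<open>k\<close> curves
  crossing at nonzero angles, which cannot all lie on the circle, so no double root occurs for
  \<open>\<alpha> > cn p\<close>.
\<close>

text \<open>Locally \<open>f = h ^ k\<close> with \<open>k \<ge> 2\<close>, and the inverse
  \<open>\<psi>\<close> of \<open>h\<close> carries a short segment through 0 in any direction
  \<open>\<omega>\<close> with \<open>\<omega> ^ k\<close> real into the unit circle. Hence
  \<open>deriv \<psi> 0 * \<omega>\<close> is tangent to the circle at \<open>\<xi>\<close> for two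
  non-parallel directions, which forces \<open>deriv \<psi> 0 = 0\<close>.\<close>

lemma critical_point_real_preimage_not_within_circle:
  assumes hol: "f holomorphic_on ball \<xi> r" and "r > 0" and f0: "f \<xi> = 0" and df0: "deriv f \<xi> = 0"
    and circ: "\<And>w. w \<in> ball \<xi> r \<Longrightarrow> f w \<in> \<real> \<Longrightarrow> cmod w = 1"
  shows False
proof -
  \<comment> \<open>Otherwise \<open>f\<close> vanishes on the whole ball, which would then lie in
    the unit circle; a radial displacement of \<open>\<xi>\<close> by \<open>r/2\<close> leaves the
    circle.\<close>
  have nconst: "\<exists>n>0. (deriv ^^ n) f \<xi> \<noteq> 0"
  proof (rule ccontr)
    assume "\<not> ?thesis"
    then have "(deriv ^^ n) f \<xi> = 0" if "0 < n" for n using that by blast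
    then have "f w = 0" if "w \<in> ball \<xi> r" for w
      using holomorphic_fun_eq_const_on_connected[OF hol, of \<xi> w] that f0 \<open>r > 0\<close> by simp
    then have cm: "cmod w = 1" if "w \<in> ball \<xi> r" for w
      using circ that by simp
    have c1: "cmod \<xi> = 1" using cm \<open>r > 0\<close> by simp
    have "cmod (\<xi> + of_real (r/2) * \<xi>) = 1"
      using \<open>r > 0\<close> c1 by (intro cm) (simp add: dist_norm norm_mult)
    moreover have "cmod (\<xi> + of_real (r/2) * \<xi>) = cmod (of_real (1 + r/2) * \<xi>)"
      by (simp add: algebra_simps)
    ultimately show False
      using \<open>r > 0\<close> c1 unfolding norm_mult norm_of_real by simp
  qed
  define k where "k = (LEAST n. 0 < n \<and> (deriv ^^ n) f \<xi> \<noteq> 0)"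
  have k: "0 < k" "(deriv ^^ k) f \<xi> \<noteq> 0"
    using LeastI_ex[OF nconst] unfolding k_def by auto
  have kmin: "(deriv ^^ i) f \<xi> = 0" if "0 < i" "i < k" for i
    using not_less_Least that unfolding k_def by blast
  have "k \<noteq> 1" using k df0 by auto
  then have k2: "k \<ge> 2" using k by simp
  obtain g r1 where r1: "0 < r1" and holg: "g holomorphic_on ball \<xi> r1"
    and fg: "\<And>w. w \<in> ball \<xi> r1 \<Longrightarrow> f w - f \<xi> = ((w - \<xi>) * g w) ^ k"
    and g0: "\<And>w. w \<in> ball \<xi> r1 \<Longrightarrow> g w \<noteq> 0"
    using holomorphic_factor_order_of_zero_strong[OF hol _ _ k kmin] \<open>r > 0\<close> 
    by (metis centre_in_ball open_ball)
  \<comment> \<open>\<open>h\<close> is a local coordinate in which \<open>f\<close> is the \<open>k\<close>-th power.\<close>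
  define h where "h = (\<lambda>w. (w - \<xi>) * g w)"
  have holh: "h holomorphic_on ball \<xi> r1"
    unfolding h_def by (intro holomorphic_intros holg)
  have "(g has_field_derivative deriv g \<xi>) (at \<xi>)"
    using holg r1 by (intro holomorphic_derivI) auto
  then have "(h has_field_derivative g \<xi>) (at \<xi>)"
    unfolding h_def by (auto intro!: derivative_eq_intros)
  then have dh: "deriv h \<xi> \<noteq> 0"
    using g0 r1 by (simp add: DERIV_imp_deriv)
  obtain r2 where r2: "r2 > 0" "ball \<xi> r2 \<subseteq> ball \<xi> r1" "inj_on h (ball \<xi> r2)"
    using has_complex_derivative_locally_injective[OF holh _ _ dh] r1 by auto
  define U where "U = ball \<xi> (min r r2)"
  have U: "open U" "\<xi> \<in> U" "U \<subseteq> ball \<xi> r" "U \<subseteq> ball \<xi> r1" "U \<subseteq> ball \<xi> r2"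
    using r2 \<open>r > 0\<close> by (auto simp: U_def)
  have holU: "h holomorphic_on U" and injU: "inj_on h U"
    using holh r2 U by (auto intro: holomorphic_on_subset inj_on_subset)
  obtain \<psi> where hol\<psi>: "\<psi> holomorphic_on h ` U"
    and d\<psi>: "\<And>z. z \<in> U \<Longrightarrow> deriv h z * deriv \<psi> (h z) = 1"
    and \<psi>: "\<And>z. z \<in> U \<Longrightarrow> \<psi> (h z) = z"
    using holomorphic_has_inverse[OF holU \<open>open U\<close> injU] by blast
  have "open (h ` U)" using open_mapping_thm3[OF holU \<open>open U\<close> injU] .
  moreover have h\<xi>: "h \<xi> = 0" by (simp add: h_def)
  ultimately obtain e where e: "e > 0" "ball 0 e \<subseteq> h ` U"
    using U by (metis imageI openE)
  have \<psi>0: "\<psi> 0 = \<xi>" and d0: "deriv \<psi> 0 \<noteq> 0"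
    using \<psi>[OF \<open>\<xi> \<in> U\<close>] d\<psi>[OF \<open>\<xi> \<in> U\<close>] h\<xi> by auto
  have D\<psi>: "(\<psi> has_field_derivative deriv \<psi> 0) (at 0)"
    using hol\<psi> e \<open>open (h ` U)\<close> by (intro holomorphic_derivI[of _ "h ` U"]) auto
  \<comment> \<open>On the segment \<open>t \<omega>\<close> the value of \<open>f\<close> is
    \<open>(t \<omega>) ^ k\<close>, which is real, so the image curve has constant norm 1.
    Differentiating the squared norm at \<open>t = 0\<close> gives orthogonality to the
    radius.\<close>
  have tangent: "\<xi> \<bullet> (deriv \<psi> 0 * \<omega>) = 0" if \<omega>: "\<omega> ^ k \<in> \<real>" "cmod \<omega> = 1" for \<omega>
  proof -
    have on: "\<psi> (of_real t * \<omega>) \<bullet> \<psi> (of_real t * \<omega>) = 1" if "\<bar>t\<bar> < e" for t :: real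
    proof -
      have "of_real t * \<omega> \<in> ball 0 e" using that \<omega> by (simp add: norm_mult)
      then obtain w where w: "w \<in> U" "h w = of_real t * \<omega>" using e by (metis imageE subsetD)
      have "f w = (h w) ^ k" using fg[of w] w U f0 by (auto simp: h_def)
      also have "\<dots> \<in> \<real>" using w \<omega> by (auto simp: power_mult_distrib)
      finally have "cmod w = 1" using circ w U by auto
      then show ?thesis using \<psi>[of w] w by (simp flip: power2_norm_eq_inner)
    qed
    have "((\<lambda>t. \<psi> (of_real t * \<omega>)) has_vector_derivative \<omega> * deriv \<psi> 0) (at 0)"
    proof -
      have "((\<lambda>t::real. of_real t * \<omega>) has_vector_derivative \<omega>) (at 0)"
        by (auto intro!: derivative_eq_intros simp: has_vector_derivative_def scaleR_conv_of_real)
      from field_vector_diff_chain_at[OF this, of \<psi> "deriv \<psi> 0"] D\<psi>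
      show ?thesis by (simp add: o_def)
    qed
    from has_derivative_inner[OF this[unfolded has_vector_derivative_def] this[unfolded has_vector_derivative_def]]
    have D: "((\<lambda>t. \<psi> (of_real t * \<omega>) \<bullet> \<psi> (of_real t * \<omega>)) has_real_derivative
        2 * (\<xi> \<bullet> (deriv \<psi> 0 * \<omega>))) (at 0)"
      unfolding has_field_derivative_def
      by (rule has_derivative_eq_rhs) (simp add: \<psi>0 inner_commute algebra_simps fun_eq_iff)
    have "2 * (\<xi> \<bullet> (deriv \<psi> 0 * \<omega>)) = 0"
      using on[of 0] on e(1) by (intro DERIV_local_const[OF D e(1)]) auto
    then show ?thesis by simp
  qed
  \<comment> \<open>The directions used are 1 and \<open>cis (pi / k)\<close>, whose
    \<open>k\<close>-th powers are 1 and -1. They are not parallel because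
    \<open>0 < pi / k < pi\<close>, which is where \<open>k \<ge> 2\<close> enters.\<close>
  have cis_k: "cis (pi / k) ^ k \<in> \<real>"
    unfolding Complex.DeMoivre using k(1) by simp
  have t1: "\<xi> \<bullet> deriv \<psi> 0 = 0" using tangent[of 1] by simp
  have t2: "\<xi> \<bullet> (deriv \<psi> 0 * cis (pi / k)) = 0" by (rule tangent[OF cis_k]) simp
  have "sin (pi / k) > 0"
    using k2 by (intro sin_gt_zero) (auto simp: field_simps)
  moreover have "\<xi> \<bullet> (deriv \<psi> 0 * cis (pi / k)) =
      cos (pi / k) * (\<xi> \<bullet> deriv \<psi> 0) + sin (pi / k) * (Im \<xi> * Re (deriv \<psi> 0) - Re \<xi> * Im (deriv \<psi> 0))"
    by (simp add: inner_complex_def algebra_simps)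
  ultimately have "Im \<xi> * Re (deriv \<psi> 0) - Re \<xi> * Im (deriv \<psi> 0) = 0"
    using t1 t2 by simp
  \<comment> \<open>The inner product and the cross term are, up to sign, the real and imaginary
    parts of \<open>cnj \<xi> * deriv \<psi> 0\<close>.\<close>
  moreover have "(cmod (cnj \<xi> * deriv \<psi> 0))\<^sup>2 = 
      (\<xi> \<bullet> deriv \<psi> 0)\<^sup>2 + (Im \<xi> * Re (deriv \<psi> 0) - Re \<xi> * Im (deriv \<psi> 0))\<^sup>2"
    unfolding cmod_power2 by (simp add: inner_complex_def algebra_simps power2_eq_square)
  ultimately have "cnj \<xi> * deriv \<psi> 0 = 0" using t1 by simp
  moreover have "cmod \<xi> = 1" using circ f0 \<open>r > 0\<close> by simp
  ultimately show False using d0 by auto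
qed

text \<open>Each root of \<open>A\<close> yields a nearby root of the perturbed polynomial on the
  circle, and the degree bound leaves room for no others. Keeping \<open>A\<close> and
  \<open>B\<close> general allows perturbation both at infinity and at a finite parameter;
  \<open>S\<close> holds the finitely many points where the reflection symmetry is not at
  hand.\<close>

lemma rsquarefree_circle_rooted_perturb:
  fixes A B :: "complex poly"
  assumes sqf: "rsquarefree A" and circ: "circle_rooted A" and deg: "degree A > 0"
    and degB: "degree B \<le> degree A"
    and cop: "\<And>z. poly A z = 0 \<Longrightarrow> poly B z \<noteq> 0" and "finite S"
    and sym: "\<And>w t. w \<noteq> 0 \<Longrightarrow> w \<notin> S \<Longrightarrow> poly (A + smult (of_real t) B) w = 0 \<Longrightarrow>
      poly (A + smult (of_real t) B) (inverse (cnj w)) = 0"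
  shows "\<forall>\<^sub>F t in nhds 0. circle_rooted (A + smult (of_real t) B)"
proof -
  let ?C = "\<lambda>t::real. A + smult (of_real t) B"
  have A0: "A \<noteq> 0" using deg by auto
  define R where "R = {z. poly A z = 0}"
  have finR: "finite R" using poly_roots_finite[OF A0] by (simp add: R_def)
  have "degree A = degree (smult (lead_coeff A) (\<Prod>z\<in>R. [:-z, 1:]))"
    using complex_poly_decompose_rsquarefree[OF sqf] by (simp add: R_def)
  also have "\<dots> = card R"
    using A0 by (simp add: degree_prod_sum_eq)
  finally have cardR: "card R = degree A" by simp
  \<comment> \<open>\<open>d z\<close> bounds from below the distance from \<open>z\<close> to the
    other roots, so the balls of radius \<open>d z / 2\<close> around the roots are disjoint and the
    roots found in them are distinct.\<close>
  have "\<exists>d>0. \<forall>y\<in>R. y \<noteq> z \<longrightarrow> d \<le> dist z y" for z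
    using finite_set_avoid[OF finR] by blast
  then obtain d where d0: "\<And>z. d z > 0" and d: "\<And>z y. y \<in> R \<Longrightarrow> y \<noteq> z \<Longrightarrow> d z \<le> dist z y"
    by metis
  have local_root: "\<forall>\<^sub>F t in nhds 0. \<exists>w\<in>ball z (d z / 2). cmod w = 1 \<and> poly (?C t) w = 0"
    if z: "z \<in> R" for z
  proof -
    define f where "f = (\<lambda>w. - poly A w / poly B w)"
    have fz: "f z = 0" and Bz: "poly B z \<noteq> 0" and cz: "cmod z = 1"
      using z cop circ by (auto simp: f_def R_def circle_rooted_def)
    have f_eq: "f w = of_real t \<longleftrightarrow> poly (?C t) w = 0" if "poly B w \<noteq> 0" for w t
    proof -
      have "f w = of_real t \<longleftrightarrow> - poly A w = of_real t * poly B w"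
        unfolding f_def by (rule nonzero_divide_eq_eq[OF that])
      then show ?thesis by (simp add: neg_eq_iff_add_eq_0)
    qed
    have "\<forall>\<^sub>F w in nhds z. poly B w \<noteq> 0"
      using Bz by (intro tendsto_imp_eventually_ne[OF _ Bz]) (auto intro!: tendsto_eq_intros simp: filterlim_ident)
    moreover have "\<forall>\<^sub>F w in nhds z. w \<noteq> 0"
      using cz by (intro t1_space_nhds) auto
    \<comment> \<open>The centre \<open>z\<close> may itself belong to \<open>S\<close>. It is not
      removed, since a perturbed root equal to \<open>z\<close> is on the circle without any appeal
      to symmetry.\<close>
    moreover have "\<forall>\<^sub>F w in nhds z. w \<notin> S - {z}"
    proof -
      have "open (- (S - {z}))" using \<open>finite S\<close> by (intro open_Compl finite_imp_closed) simp
      then show ?thesis by (rule eventually_nhds_in_open[THEN eventually_mono]) auto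
    qed
    moreover have "\<forall>\<^sub>F w in nhds z. w \<in> ball z (d z / 2)"
      using d0 by (intro eventually_nhds_in_open) auto
    ultimately have "\<forall>\<^sub>F w in nhds z. poly B w \<noteq> 0 \<and> w \<noteq> 0 \<and> w \<notin> S - {z} \<and> w \<in> ball z (d z / 2)"
      by eventually_elim simp
    then obtain r1 where r1: "r1 > 0" "\<And>w. w \<in> ball z r1 \<Longrightarrow>
        poly B w \<noteq> 0 \<and> w \<noteq> 0 \<and> w \<notin> S - {z} \<and> w \<in> ball z (d z / 2)"
      unfolding eventually_nhds_metric by (auto simp: dist_commute)
    have hol: "f holomorphic_on ball z r1"
      unfolding f_def using r1 by (intro holomorphic_intros) auto
    have "(f has_field_derivative - poly (pderiv A) z / poly B z) (at z)"
      unfolding f_def using z Bz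
      by (auto intro!: derivative_eq_intros simp: R_def field_simps)
    moreover have "poly (pderiv A) z \<noteq> 0"
      using sqf z unfolding rsquarefree_roots R_def by blast
    ultimately have df: "deriv f z \<noteq> 0" using Bz by (simp add: DERIV_imp_deriv)
    obtain r2 where r2: "r2 > 0" "ball z r2 \<subseteq> ball z r1" "inj_on f (ball z r2)"
      using has_complex_derivative_locally_injective[OF hol _ _ df] r1 by auto
    have invz: "inverse (cnj z) = z"
      using cz by (metis complex_cnj_inverse complex_div_cnj complex_norm_square divide_inverse inverse_unique mult.commute of_real_1 one_power2)
    \<comment> \<open>Reflection is continuous and fixes \<open>z\<close>, so a small enough ball is
      reflected into the ball on which \<open>f\<close> is injective.\<close>
    have "((\<lambda>w. inverse (cnj w)) \<longlongrightarrow> z) (nhds z)"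
      using tendsto_inverse[OF tendsto_cnj[OF filterlim_ident], of z] cz unfolding invz by force
    then have "\<forall>\<^sub>F w in nhds z. inverse (cnj w) \<in> ball z r2"
      using r2 by (intro topological_tendstoD) auto
    moreover have "\<forall>\<^sub>F w in nhds z. w \<in> ball z r2"
      using r2 by (intro eventually_nhds_in_open) auto
    ultimately have "\<forall>\<^sub>F w in nhds z. inverse (cnj w) \<in> ball z r2 \<and> w \<in> ball z r2"
      by eventually_elim simp
    then obtain r3 where r3: "r3 > 0" "\<And>w. w \<in> ball z r3 \<Longrightarrow>
        inverse (cnj w) \<in> ball z r2 \<and> w \<in> ball z r2"
      unfolding eventually_nhds_metric by (auto simp: dist_commute)
    have "ball z r3 \<subseteq> ball z r2" using r3 by blast
    then have "open (f ` ball z r3)"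
      using r2 hol by (intro open_mapping_thm3) (auto intro: holomorphic_on_subset inj_on_subset)
    moreover have "0 \<in> f ` ball z r3" using r3 fz by (auto intro!: image_eqI[of _ _ z])
    ultimately have "\<forall>\<^sub>F y in nhds 0. y \<in> f ` ball z r3" by (rule eventually_nhds_in_open)
    moreover have "filterlim complex_of_real (nhds 0) (nhds 0)"
      by (auto intro!: tendsto_eq_intros simp: filterlim_ident)
    ultimately have "\<forall>\<^sub>F t::real in nhds 0. complex_of_real t \<in> f ` ball z r3"
      by (rule eventually_compose_filterlim)
    then show ?thesis
    proof eventually_elim
      case (elim t)
      then obtain w where w: "w \<in> ball z r3" "f w = of_real t" by auto
      have w2: "w \<in> ball z r2" "inverse (cnj w) \<in> ball z r2" using r3 w by auto
      then have w1: "w \<in> ball z r1" "inverse (cnj w) \<in> ball z r1" using r2 by auto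
      have root: "poly (?C t) w = 0" using w r1(2)[OF w1(1)] f_eq by blast
      have "cmod w = 1"
      proof (cases "w = z")
        case False
        then have "poly (?C t) (inverse (cnj w)) = 0"
          using r1(2)[OF w1(1)] root by (intro sym) auto
        then have "f (inverse (cnj w)) = f w" using w r1(2)[OF w1(2)] f_eq by metis
        then have "inverse (cnj w) = w" using w2 r2(3) by (meson inj_onD)
        then have "w * cnj w = 1" using r1(2)[OF w1(1)] by (metis complex_cnj_zero_iff left_inverse)
        then show ?thesis
          by (metis complex_mod_sqrt_Re_mult_cnj one_complex.sel(1) real_sqrt_one)
      qed (use cz in simp)
      then show ?case using root r1(2)[OF w1(1)] by blast
    qed
  qed
  then have "\<forall>\<^sub>F t in nhds 0. \<forall>z\<in>R. \<exists>w\<in>ball z (d z / 2). cmod w = 1 \<and> poly (?C t) w = 0"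
    using finR by (simp add: eventually_ball_finite)
  then show ?thesis
  proof eventually_elim
    case (elim t)
    then obtain \<rho> where \<rho>: "\<And>z. z \<in> R \<Longrightarrow> \<rho> z \<in> ball z (d z / 2)"
      "\<And>z. z \<in> R \<Longrightarrow> cmod (\<rho> z) = 1" "\<And>z. z \<in> R \<Longrightarrow> poly (?C t) (\<rho> z) = 0"
      by metis
    have "inj_on \<rho> R"
    proof (rule inj_onI, rule ccontr)
      fix x y assume xy: "x \<in> R" "y \<in> R" "\<rho> x = \<rho> y" "x \<noteq> y"
      have "dist x y < d x / 2 + d y / 2"
        using \<rho>(1)[OF xy(1)] \<rho>(1)[OF xy(2)] xy(3) dist_triangle2[of x y "\<rho> x"]
        by (simp add: dist_commute)
      then show False using d[of y x] d[of x y] xy by (simp add: dist_commute)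
    qed
    have C0: "?C t \<noteq> 0"
    proof
      assume C: "?C t = 0"
      obtain z where z: "poly A z = 0"
        using alg_closed_imp_poly_has_root[OF deg] by blast
      have "poly (?C t) z = 0" by (simp only: C poly_0)
      then have "t = 0" using z cop by simp
      then show False using C A0 by simp
    qed
    have "degree (?C t) \<le> degree A"
      using degB by (intro degree_add_le) (auto intro: order.trans[OF degree_smult_le])
    then have "card {w. poly (?C t) w = 0} \<le> card (\<rho> ` R)"
      using card_poly_roots_bound[OF C0] cardR card_image[OF \<open>inj_on \<rho> R\<close>] by simp
    moreover have "\<rho> ` R \<subseteq> {w. poly (?C t) w = 0}" using \<rho> by auto
    ultimately have im: "\<rho> ` R = {w. poly (?C t) w = 0}"
      using poly_roots_finite[OF C0] by (intro card_seteq) auto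
    show ?case
      unfolding circle_rooted_def
    proof (intro allI impI)
      fix w assume "poly (?C t) w = 0"
      then have "w \<in> \<rho> ` R" unfolding im by (rule CollectI)
      then show "cmod w = 1" by (rule imageE) (simp only: \<rho>(2))
    qed
  qed
qed

text \<open>Reversing the order of summation gives
  \<open>cnj w ^ n * poly q (inverse (cnj w)) = cnj (poly q w)\<close>. The reversal is about
  \<open>n\<close>, which may exceed the degree of \<open>q\<close>.\<close>

lemma conjugate_palindromic_root_reflect:
  assumes deg: "degree q \<le> n" and pal: "\<And>j. j \<le> n \<Longrightarrow> coeff q j = cnj (coeff q (n - j))"
    and "w \<noteq> 0" and root: "poly q w = 0"
  shows "poly q (inverse (cnj w)) = 0"
proof -
  have expand: "poly q x = (\<Sum>j\<le>n. coeff q j * x ^ j)" for x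
    unfolding poly_altdef using deg by (intro sum.mono_neutral_left) (auto simp: coeff_eq_0)
  have "cnj w ^ n * poly q (inverse (cnj w)) = (\<Sum>j\<le>n. coeff q j * cnj w ^ (n - j))"
    unfolding expand sum_distrib_left
    using \<open>w \<noteq> 0\<close> by (intro sum.cong refl) (simp add: power_diff field_simps)
  also have "\<dots> = (\<Sum>j\<le>n. coeff q (n - j) * cnj w ^ j)"
    by (rule sum.reindex_bij_witness[of _ "\<lambda>j. n - j" "\<lambda>j. n - j"]) auto
  also have "\<dots> = (\<Sum>j\<le>n. cnj (coeff q j * w ^ j))"
  proof (intro sum.cong refl)
    fix j assume "j \<in> {..n}"
    then show "coeff q (n - j) * cnj w ^ j = cnj (coeff q j * w ^ j)"
      using pal[of j] by simp
  qed
  also have "\<dots> = cnj (poly q w)" unfolding expand by simp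
  finally show ?thesis using root \<open>w \<noteq> 0\<close> by simp
qed

theorem mainTheorem6:
  fixes p :: "complex poly" and n :: nat
  assumes "p \<noteq> 0" and "darga p = n" and "self_inversive p" and "trim p"
  shows "has_double_root (shifted_poly p (circle_number p) div gcd p (monom 1 n + 1)) \<and>
    (\<forall>\<alpha>::real. has_double_root (shifted_poly p \<alpha> div gcd p (monom 1 n + 1))
        \<longrightarrow> \<alpha> \<le> circle_number p)"
proof -

  \<comment> \<open>Reduction to the coprime pair \<open>u\<close>, \<open>v\<close>\<close>
  have p0: "coeff p 0 = 0" using \<open>trim p\<close> by (simp add: trim_def poly_0_coeff_0)
  \<comment> \<open>Vanishing at 0 makes the lowest exponent of \<open>p\<close> positive, so the
    degree of \<open>p\<close> is strictly below its darga.\<close>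
  have "coeff p (LEAST j. coeff p j \<noteq> 0) \<noteq> 0"
    by (rule LeastI[of "\<lambda>j. coeff p j \<noteq> 0" "degree p"]) (simp add: \<open>p \<noteq> 0\<close>)
  then have "(LEAST j. coeff p j \<noteq> 0) > 0" using p0 by (metis gr0I)
  then have degp: "degree p < n" using \<open>darga p = n\<close> by (simp add: darga_def)
  define e :: "complex poly" where "e = monom 1 n + 1"
  have dege: "degree e = n"
    unfolding e_def using degp by (subst degree_add_eq_left) (auto simp: degree_monom_eq)
  have poly_e: "poly e z = z ^ n + 1" for z by (simp add: e_def poly_monom)
  have e0: "e \<noteq> 0" using dege degp by auto
  define g where "g = gcd p e"
  define u where "u = p div g"
  define v where "v = e div g"
  have g0: "g \<noteq> 0" using \<open>p \<noteq> 0\<close> by (simp add: g_def)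
  have pgu: "p = g * u" and egv: "e = g * v" by (simp_all add: u_def v_def g_def)
  have "coprime u v" unfolding u_def v_def g_def using e0 by (intro div_gcd_coprime) auto
  then have cop: "poly u z \<noteq> 0" if "poly v z = 0" for z
    using that coprime_common_divisor[of u v "[:-z, 1:]"] by (auto simp: poly_eq_0_iff_dvd is_unit_pCons_iff)
  have u0: "u \<noteq> 0" and v0: "v \<noteq> 0" using pgu egv \<open>p \<noteq> 0\<close> e0 by auto
  have "degree p = degree g + degree u" "n = degree g + degree v"
    using degree_mult_eq[OF g0 u0] degree_mult_eq[OF g0 v0] dege pgu egv by simp_all
  then have duv: "degree u < degree v" using degp by simp
  \<comment> \<open>Since \<open>e\<close> takes the value 1 at 0, \<open>g\<close> is nonzero there
    and \<open>u\<close> inherits the zero of \<open>p\<close>. This later excludes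
    \<open>c = 0\<close>.\<close>
  have "poly g 0 * poly v 0 = 1" using poly_e[of 0] degp unfolding egv by (simp add: power_0_left)
  moreover have "poly g 0 * poly u 0 = 0" using \<open>trim p\<close> unfolding trim_def by (subst (asm) pgu) simp
  ultimately have pu0: "poly u 0 = 0" by auto
  have circ_e: "cmod z = 1" if "poly e z = 0" for z
  proof -
    have "z ^ n = -1" using that poly_e by (simp add: eq_neg_iff_add_eq_0)
    then have "cmod z ^ n = 1 ^ n" by (simp flip: norm_power)
    then show ?thesis using degp power_eq_iff_eq_base[of n "cmod z" 1] by auto
  qed
  have circ_g: "cmod z = 1" if "poly g z = 0" for z
    using circ_e[of z] that egv by simp
  have circ_v: "circle_rooted v"
    using circ_e egv by (simp add: circle_rooted_def)
  have sqf_v: "rsquarefree v"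
    unfolding rsquarefree_roots
  proof (intro allI notI)
    fix z assume z: "poly v z = 0 \<and> poly (pderiv v) z = 0"
    \<comment> \<open>A double root of \<open>v\<close> would be one of \<open>e\<close>, but
      \<open>n * z ^ (n - 1)\<close> has no zero on the circle.\<close>
    have "poly (pderiv e) z = 0" using z by (simp add: egv pderiv_mult)
    then have "z ^ (n - 1) = 0" using degp by (simp add: e_def pderiv_add pderiv_monom poly_monom)
    moreover have "cmod z = 1" using z circ_v by (simp add: circle_rooted_def)
    ultimately show False by auto
  qed
  define Q where "Q = (\<lambda>\<alpha>::real. smult (of_real \<alpha>) v + u)"
  have shifted: "shifted_poly p \<alpha> = g * Q \<alpha>" for \<alpha>
  proof -
    have "shifted_poly p \<alpha> = smult (of_real \<alpha>) e + p"
      using \<open>darga p = n\<close> by (simp add: shifted_poly_def e_def)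
    also have "\<dots> = smult (of_real \<alpha>) (g * v) + g * u" using pgu egv by simp
    finally show ?thesis by (simp add: Q_def algebra_simps)
  qed
  have shifted_div: "shifted_poly p \<alpha> div g = Q \<alpha>" for \<alpha>
    using g0 by (simp add: shifted)
  have circ_shifted: "circle_rooted (shifted_poly p \<alpha>) \<longleftrightarrow> circle_rooted (Q \<alpha>)" for \<alpha>
    using circ_g by (auto simp: shifted circle_rooted_def)
  have poly_Q: "poly (Q \<alpha>) z = of_real \<alpha> * poly v z + poly u z" for \<alpha> z
    by (simp add: Q_def)
  have Q0: "Q \<alpha> \<noteq> 0" for \<alpha>
  proof
    assume Q: "Q \<alpha> = 0"
    then have "degree (smult (of_real \<alpha>) v) = degree u"
      by (metis Q_def add_eq_0_iff degree_minus)
    then have "\<alpha> = 0" using duv by (cases "\<alpha> = 0") simp_all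
    then show False using Q u0 by (simp add: Q_def)
  qed
  have degQ: "degree (Q \<alpha>) = degree v" if "\<alpha> \<noteq> 0" for \<alpha>
    unfolding Q_def using that duv by (subst degree_add_eq_left) auto
  have v_at_root: "poly v z \<noteq> 0" if "poly (Q \<alpha>) z = 0" for \<alpha> z
    using that cop by (auto simp: poly_Q)
  \<comment> \<open>The coefficient symmetry is available for \<open>a * e + b * p\<close>, and
    \<open>g\<close> must then be divided out. This is safe where \<open>g\<close> is nonzero,
    because the roots of \<open>g\<close> lie on the circle and are fixed by reflection. Two real
    coefficients cover both pencils \<open>v + t u\<close> and \<open>(c + t) v + u\<close>.\<close>
  have sym: "a * poly v (inverse (cnj w)) + b * poly u (inverse (cnj w)) = 0"
    if w: "w \<noteq> 0" "poly g w \<noteq> 0" and root: "a * poly v w + b * poly u w = 0"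
      and real: "a \<in> \<real>" "b \<in> \<real>" for a b w
  proof -
    define q where "q = smult a e + smult b p"
    have q: "poly q x = poly g x * (a * poly v x + b * poly u x)" for x
      unfolding q_def by (subst pgu, subst egv) (simp add: algebra_simps)
    have degq: "degree q \<le> n" unfolding q_def using dege degp
      by (intro degree_add_le) (auto intro: order.trans[OF degree_smult_le])
    have pal: "coeff q j = cnj (coeff q (n - j))" if "j \<le> n" for j
    proof -
      have ej: "cnj (coeff e (n - j)) = coeff e j"
        using that degp by (auto simp: e_def coeff_1)
      have pj: "cnj (coeff p (n - j)) = coeff p j"
        using \<open>self_inversive p\<close> that unfolding self_inversive_def \<open>darga p = n\<close> by metis
      have "cnj (coeff q (n - j)) = a * cnj (coeff e (n - j)) + b * cnj (coeff p (n - j))"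
        using real by (simp add: q_def Reals_cnj_iff)
      then show ?thesis unfolding ej pj by (simp add: q_def)
    qed
    have "poly q w = 0" using root by (simp add: q)
    then have "poly q (inverse (cnj w)) = 0"
      using conjugate_palindromic_root_reflect[OF degq _ w(1)] pal by metis
    moreover have "poly g (inverse (cnj w)) \<noteq> 0"
    proof
      assume *: "poly g (inverse (cnj w)) = 0"
      then have "cmod w = 1" using circ_g[OF *] by (simp add: norm_inverse)
      then have "inverse (cnj w) = w"
        by (metis complex_norm_square inverse_unique mult.commute of_real_1 one_power2)
      then show False using * w by simp
    qed
    ultimately show ?thesis using q by auto
  qed
  have fin_g: "finite {w. poly g w = 0}" using g0 by (rule poly_roots_finite)

  \<comment> \<open>Finiteness and positivity of the circle number\<close>
  define T where "T = {\<alpha>. \<alpha> > 0 \<and> (\<forall>\<beta>>\<alpha>. circle_rooted (Q \<beta>))}"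
  define c where "c = circle_number p"
  have c_T: "c = Inf T" by (simp add: c_def circle_number_def T_def circ_shifted)
  have bdd: "bdd_below T" by (rule bdd_belowI[of _ 0]) (auto simp: T_def)
  \<comment> \<open>This is the perturbation at \<open>\<alpha> = \<infinity>\<close>: with
    \<open>t = 1 / \<beta>\<close> the polynomial is \<open>Q \<beta>\<close> divided by
    \<open>\<beta>\<close>.\<close>
  have "\<forall>\<^sub>F t in nhds 0. circle_rooted (v + smult (of_real t) u)"
  proof (rule rsquarefree_circle_rooted_perturb[OF sqf_v circ_v _ _ cop fin_g])
    fix w t assume "w \<noteq> 0" "w \<notin> {w. poly g w = 0}" "poly (v + smult (of_real t) u) w = 0"
    then show "poly (v + smult (of_real t) u) (inverse (cnj w)) = 0"
      using sym[of w 1 "of_real t"] by simp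
  qed (use duv in auto)
  then obtain \<delta> where \<delta>: "\<delta> > 0" "\<And>t. \<bar>t\<bar> < \<delta> \<Longrightarrow> circle_rooted (v + smult (of_real t) u)"
    unfolding eventually_nhds_metric by (auto simp: dist_real_def)
  have "1 / \<delta> \<in> T"
  proof -
    have "circle_rooted (Q \<beta>)" if "\<beta> > 1 / \<delta>" for \<beta>
    proof -
      have "\<beta> > 0" using that \<delta> by (meson less_trans zero_less_divide_1_iff)
      then have "circle_rooted (v + smult (of_real (1 / \<beta>)) u)"
        using that \<delta>(1) by (intro \<delta>(2)) (simp add: field_simps)
      moreover have "Q \<beta> = smult (of_real \<beta>) (v + smult (of_real (1 / \<beta>)) u)"
        using \<open>\<beta> > 0\<close> by (simp add: Q_def smult_add_right)
      ultimately show ?thesis using \<open>\<beta> > 0\<close> by (simp add: circle_rooted_def)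
    qed
    then show ?thesis using \<delta> by (simp add: T_def)
  qed
  then have T_ne: "T \<noteq> {}" by auto
  have c_ge: "c \<ge> 0" unfolding c_T using T_ne by (intro cInf_greatest) (auto simp: T_def)
  have above: "circle_rooted (Q \<beta>)" if "\<beta> > c" for \<beta>
    using cInf_lessD[OF T_ne that[unfolded c_T]] by (auto simp: T_def)

  \<comment> \<open>By the open mapping theorem, a root of \<open>Q c\<close> off the circle would give one of \<open>Q \<beta>\<close> for some \<open>\<beta> > c\<close>.\<close>
  have circ_Qc: "circle_rooted (Q c)"
    unfolding circle_rooted_def
  proof (intro allI impI, rule ccontr)
    fix z assume z: "poly (Q c) z = 0" "cmod z \<noteq> 1"
    define f where "f = (\<lambda>w. - poly u w / poly v w)"
    have f_eq: "f w = of_real \<alpha> \<longleftrightarrow> poly (Q \<alpha>) w = 0" if "poly v w \<noteq> 0" for w \<alpha>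
    proof -
      have "f w = of_real \<alpha> \<longleftrightarrow> - poly u w = of_real \<alpha> * poly v w"
        unfolding f_def by (rule nonzero_divide_eq_eq[OF that])
      then show ?thesis unfolding poly_Q by (metis add.commute neg_eq_iff_add_eq_0)
    qed
    have "open {w. poly v w \<noteq> 0 \<and> cmod w \<noteq> 1}"
      by (intro open_Collect_conj open_Collect_neq continuous_intros)
    then obtain r where r: "r > 0" "ball z r \<subseteq> {w. poly v w \<noteq> 0 \<and> cmod w \<noteq> 1}"
      using z v_at_root[OF z(1)] by (metis (mono_tags, lifting) mem_Collect_eq openE)
    have fz: "f z = of_real c" using f_eq v_at_root z by blast
    have hol: "f holomorphic_on ball z r"
      unfolding f_def using r by (intro holomorphic_intros) auto
    have "\<not> f constant_on ball z r"
    proof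
      assume "f constant_on ball z r"
      then have "f w = of_real c" if "w \<in> ball z r" for w
        using fz that r(1) unfolding constant_on_def by (metis centre_in_ball)
      then have "ball z r \<subseteq> {w. poly (Q c) w = 0}" using f_eq r by blast
      then have "finite (ball z r)" using poly_roots_finite[OF Q0] finite_subset by blast
      then show False using r(1) finite_imp_not_open[of "ball z r"] by simp
    qed
    then have "open (f ` ball z r)"
      by (intro open_mapping_thm[OF hol]) auto
    moreover have "of_real c \<in> f ` ball z r" using r fz by (metis centre_in_ball imageI)
    ultimately obtain \<epsilon> where \<epsilon>: "\<epsilon> > 0" "ball (of_real c) \<epsilon> \<subseteq> f ` ball z r"
      by (metis openE)
    then have "of_real (c + \<epsilon> / 2) \<in> f ` ball z r"
      by (intro subsetD[OF \<epsilon>(2)]) (simp add: dist_norm)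
    then obtain w where w: "w \<in> ball z r" "f w = of_real (c + \<epsilon> / 2)" by auto
    then have "poly (Q (c + \<epsilon> / 2)) w = 0" "cmod w \<noteq> 1" using r f_eq by blast+
    then show False using above[of "c + \<epsilon> / 2"] \<epsilon> by (simp add: circle_rooted_def)
  qed
  \<comment> \<open>For \<open>c = 0\<close> the polynomial \<open>Q c\<close> would be
    \<open>u\<close>, which has the root 0 off the circle.\<close>
  have c_pos: "c > 0"
  proof (rule ccontr)
    assume "\<not> c > 0"
    then have "poly (Q c) 0 = 0" using c_ge pu0 by (simp add: poly_Q)
    then show False using circ_Qc by (auto simp: circle_rooted_def)
  qed

  \<comment> \<open>A double root at the circle number\<close>
  have "has_double_root (Q c)"
  proof (rule ccontr)
    assume "\<not> has_double_root (Q c)"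
    then have "\<not> order z (Q c) \<ge> 2" for z using Q0 by (auto simp: has_double_root_def)
    then have "order z (Q c) = 0 \<or> order z (Q c) = 1" for z
      by (metis One_nat_def less_2_cases not_le)
    then have sqf: "rsquarefree (Q c)" using Q0 by (simp add: rsquarefree_def)
    have shift: "Q c + smult (of_real t) v = Q (c + t)" for t
      by (simp add: Q_def smult_add_left)
    have "\<forall>\<^sub>F t in nhds 0. circle_rooted (Q c + smult (of_real t) v)"
    proof (rule rsquarefree_circle_rooted_perturb[OF sqf circ_Qc _ _ v_at_root fin_g])
      fix w t assume "w \<noteq> 0" "w \<notin> {w. poly g w = 0}" "poly (Q c + smult (of_real t) v) w = 0"
      then show "poly (Q c + smult (of_real t) v) (inverse (cnj w)) = 0"
        using sym[of w "of_real (c + t)" 1] unfolding shift poly_Q by simp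
    qed (use duv degQ c_pos in auto)
    then obtain \<delta> where \<delta>: "\<delta> > 0" "\<And>t. \<bar>t\<bar> < \<delta> \<Longrightarrow> circle_rooted (Q (c + t))"
      unfolding eventually_nhds_metric shift by (auto simp: dist_real_def)
    \<comment> \<open>The term \<open>c / 2\<close> keeps \<open>\<alpha>\<close> positive, as
      membership in \<open>T\<close> demands; \<open>c - \<delta> / 2\<close> keeps the values
      between \<open>\<alpha>\<close> and \<open>c\<close> within the reach of the perturbation. So
      \<open>\<alpha>\<close> is a member of \<open>T\<close> below its infimum.\<close>
    define \<alpha> where "\<alpha> = max (c / 2) (c - \<delta> / 2)"
    have "circle_rooted (Q \<beta>)" if "\<beta> > \<alpha>" for \<beta>
      using above[of \<beta>] \<delta>(2)[of "\<beta> - c"] that \<delta>(1) c_pos circ_Qc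
      by (cases "\<beta> > c") (auto simp: \<alpha>_def)
    then have "\<alpha> \<in> T" using c_pos by (simp add: T_def \<alpha>_def)
    then have "c \<le> \<alpha>" unfolding c_T using bdd by (intro cInf_lower)
    then show False using c_pos \<delta>(1) by (simp add: \<alpha>_def max_def split: if_splits)
  qed

  \<comment> \<open>No double root above the circle number\<close>
  moreover have "\<alpha> \<le> c" if "has_double_root (Q \<alpha>)" for \<alpha>
  proof (rule ccontr)
    assume "\<not> \<alpha> \<le> c"
    have "\<not> rsquarefree (Q \<alpha>)"
      using that unfolding has_double_root_def rsquarefree_def
      by (metis not_numeral_le_zero numeral_le_one_iff semiring_norm(69))
    then obtain z where z: "poly (Q \<alpha>) z = 0" "poly (pderiv (Q \<alpha>)) z = 0"
      unfolding rsquarefree_roots by blast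
    \<comment> \<open>This is \<open>- u / v\<close> recentred by \<open>\<alpha>\<close>, so that
      the critical value is 0: where \<open>v\<close> is nonzero, \<open>f w = t\<close> means that
      \<open>w\<close> is a root of \<open>Q (\<alpha> + t)\<close>. For
      \<open>\<bar>t\<bar> < \<alpha> - c\<close> that polynomial is still circle rooted.\<close>
    define f where "f = (\<lambda>w. - poly (Q \<alpha>) w / poly v w)"
    have vz: "poly v z \<noteq> 0" using v_at_root z by blast
    have fz: "f z = 0" using z by (simp add: f_def)
    have Df: "(f has_field_derivative 0) (at z)"
      unfolding f_def using z vz by (auto intro!: derivative_eq_intros)
    then have "(f \<longlongrightarrow> f z) (nhds z)"
      using DERIV_isCont continuous_at tendsto_at_iff_tendsto_nhds isCont_def by blast
    then have "\<forall>\<^sub>F w in nhds z. f w \<in> ball 0 (\<alpha> - c)"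
      using \<open>\<not> \<alpha> \<le> c\<close> fz by (intro topological_tendstoD) auto
    moreover have "\<forall>\<^sub>F w in nhds z. poly v w \<noteq> 0"
      using vz by (intro tendsto_imp_eventually_ne[OF _ vz]) (auto intro!: tendsto_eq_intros simp: filterlim_ident)
    ultimately have "\<forall>\<^sub>F w in nhds z. f w \<in> ball 0 (\<alpha> - c) \<and> poly v w \<noteq> 0"
      by eventually_elim simp
    then obtain r where r: "r > 0" "\<And>w. w \<in> ball z r \<Longrightarrow> f w \<in> ball 0 (\<alpha> - c) \<and> poly v w \<noteq> 0"
      unfolding eventually_nhds_metric by (auto simp: dist_commute)
    show False
    proof (rule critical_point_real_preimage_not_within_circle[of f z r])
      show "f holomorphic_on ball z r"
        unfolding f_def using r by (intro holomorphic_intros) auto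
      show "deriv f z = 0" using Df by (rule DERIV_imp_deriv)
      fix w assume w: "w \<in> ball z r" "f w \<in> \<real>"
      then obtain t where t: "f w = of_real t" by (auto elim: Reals_cases)
      have "\<bar>t\<bar> < \<alpha> - c" using r(2)[OF w(1)] t by simp
      then have circ: "circle_rooted (Q (\<alpha> + t))" by (intro above) auto
      have "poly v w \<noteq> 0" using r(2)[OF w(1)] ..
      from nonzero_divide_eq_eq[OF this] have eq: "- poly (Q \<alpha>) w = of_real t * poly v w"
        by (rule iffD1) (rule t[unfolded f_def])
      have "poly (Q (\<alpha> + t)) w = poly (Q \<alpha>) w + of_real t * poly v w"
        by (simp only: poly_Q of_real_add distrib_right add_ac)
      also have "\<dots> = 0" unfolding eq[symmetric] by (rule add.right_inverse)
      finally have "poly (Q (\<alpha> + t)) w = 0" .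
      then show "cmod w = 1" using circ by (simp add: circle_rooted_def)
    qed (use r fz in auto)
  qed
  ultimately show ?thesis
    unfolding e_def[symmetric] g_def[symmetric] c_def[symmetric] shifted_div by blast
qed

end
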